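(* Let $\mathcal{S}$ be a sequence over the finite field $\mathbb{F}_q$ that has maximal expansion complexity, i.e. for every integer $d\geq 1$ and every integer $N$, $$E_N(\mathcal{S})=d\quad\text{whenever}\quad \binom{d+1}{2}\leq N<\binom{d+2}{2}.$$ Then for every integer $d'\geq 6$ and every integer $N$, $$E^*_N(\mathcal{S})=d'\quad\text{whenever}\quad \binom{d'+1}{2}+2\leq N<\binom{d'+2}{2}.$$
   Context: For a sequence $\mathcal{S}=(s_i)_{i=0}^\infty$ over $\mathbb{F}_q$, its generating function is the formal power series $G(x)=\sum_{i=0}^\infty s_i x^i$ over $\mathbb{F}_q$. For a positive integer $N$, the $N$th expansion complexity $E_N(\mathcal{S})$ is defined to be $0$ if $s_0=\dots=s_{N-1}=0$, and otherwise the least total degree of a nonzero polynomial $h(x,y)\in\mathbb{F}_q[x,y]$ with $h(x,G(x))\equiv 0 \bmod x^N$. The $N$th i-expansion complexity (irreducible-expansion complexity) $E_N^*(\mathcal{S})$ is defined to be $0$ if $s_0=\dots=s_{N-1}=0$, and otherwise the least total degree of an irreducible polynomial $h(x,y)\in\mathbb{F}_q[x,y]$ with $h(x,G(x))\equiv 0\bmod x^N$. *)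

theory Defs
  imports "HOL-Computational_Algebra.Computational_Algebra"
begin

(* A bivariate polynomial h(x,y) is represented as an element of F[x][y]: the outer
   variable is y, the coefficients are polynomials in x, so coeff (coeff h j) i is the
   coefficient of x^i y^j. The constants of F embed as [:[:c:]:], hence the library's
   irreducible on this type is irreducibility in F[x,y]. *)

(* Convention: the zero polynomial gets total degree 0; it is never a candidate below. *)
definition total_degree :: "'a::zero poly poly \<Rightarrow> nat" where
  "total_degree h = Max (insert 0 {i + j | i j. coeff (coeff h j) i \<noteq> 0})"

definition subst_fps :: "'a::field poly poly \<Rightarrow> 'a fps \<Rightarrow> 'a fps" where
  "subst_fps h G = poly (map_poly fps_of_poly h) G"

definition generating_function :: "(nat \<Rightarrow> 'a) \<Rightarrow> 'a fps" where
  "generating_function s = Abs_fps s"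

(* In both definitions the minimum is over a nonempty set: if g is the truncation of the
   generating function below degree N, then y - g(x) is irreducible and is a candidate. *)
definition expansion_complexity :: "nat \<Rightarrow> (nat \<Rightarrow> 'a::{field,finite}) \<Rightarrow> nat" where
  "expansion_complexity N s =
     (if \<forall>i<N. s i = 0 then 0
      else LEAST d. \<exists>h. h \<noteq> 0 \<and> fps_X ^ N dvd subst_fps h (generating_function s)
                        \<and> total_degree h = d)"

definition i_expansion_complexity :: "nat \<Rightarrow> (nat \<Rightarrow> 'a::{field,finite}) \<Rightarrow> nat" where
  "i_expansion_complexity N s =
     (if \<forall>i<N. s i = 0 then 0
      else LEAST d. \<exists>h. irreducible h \<and> fps_X ^ N dvd subst_fps h (generating_function s)
                        \<and> total_degree h = d)"

end

theory Submission
  imports Defs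
begin

text \<open>
  Put \<open>T n = n choose 2\<close>. Maximality says that a nonzero polynomial \<open>f\<close> of total degree \<open>a \<ge> 1\<close>
  satisfies \<open>f(x, G(x)) \<noteq> 0\<close> modulo \<open>x ^ T (a + 2)\<close>. So if a polynomial of total degree \<open>d\<close> is a
  product of two nonconstant factors of total degrees \<open>a\<close> and \<open>b\<close>, then its value at \<open>y = G(x)\<close> has
  order at most \<open>T (a + 2) + T (b + 2) - 2 \<le> T (d + 1) + 1\<close>. Hence for \<open>N \<ge> T (d + 1) + 2\<close> every
  polynomial attaining \<open>E\<^sub>N = d\<close> is irreducible.
\<close>

lemma subst_fps_0 [simp]: "subst_fps 0 G = 0"
  by (simp add: subst_fps_def)

lemma subst_fps_pCons: "subst_fps (pCons a p) G = fps_of_poly a + G * subst_fps p G"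
  by (simp add: subst_fps_def map_poly_pCons)

lemma subst_fps_add: "subst_fps (p + q) G = subst_fps p G + subst_fps q G"
  by (induction p q rule: poly_induct2) (simp_all add: subst_fps_pCons fps_of_poly_add algebra_simps)

lemma subst_fps_smult: "subst_fps (smult a p) G = fps_of_poly a * subst_fps p G"
  by (induction p) (simp_all add: subst_fps_pCons fps_of_poly_mult algebra_simps)

lemma subst_fps_mult: "subst_fps (p * q) G = subst_fps p G * subst_fps q G"
  by (induction p)
    (simp_all add: subst_fps_pCons subst_fps_add subst_fps_smult algebra_simps)

lemma finite_total_degree_set: "finite {i + j | i j. coeff (coeff h j) i \<noteq> 0}"
proof (rule finite_subset)
  show "{i + j | i j. coeff (coeff h j) i \<noteq> 0}
      \<subseteq> (\<Union>j\<le>degree h. (\<lambda>i. i + j) ` {..degree (coeff h j)})"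
  proof safe
    fix i j
    assume nz: "coeff (coeff h j) i \<noteq> 0"
    then have "coeff h j \<noteq> 0"
      by auto
    with nz show "i + j \<in> (\<Union>j\<le>degree h. (\<lambda>i. i + j) ` {..degree (coeff h j)})"
      by (auto intro!: le_degree bexI[of _ j] imageI)
  qed
qed auto

lemma le_total_degree: "coeff (coeff h j) i \<noteq> 0 \<Longrightarrow> i + j \<le> total_degree h"
  unfolding total_degree_def using finite_total_degree_set[of h] by (intro Max_ge) auto

lemma total_degree_attained:
  assumes "h \<noteq> 0"
  obtains i j where "coeff (coeff h j) i \<noteq> 0" and "i + j = total_degree h"
proof -
  let ?A = "{i + j | i j. coeff (coeff h j) i \<noteq> 0}"
  have "coeff (coeff h (degree h)) (degree (coeff h (degree h))) \<noteq> 0"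
    using assms by simp
  then have "?A \<noteq> {}"
    by blast
  then have "total_degree h = Max ?A"
    unfolding total_degree_def using finite_total_degree_set[of h] by simp
  then have "total_degree h \<in> ?A"
    using Max_in[OF finite_total_degree_set[of h] \<open>?A \<noteq> {}\<close>] by simp
  then show ?thesis
    using that by auto
qed

text \<open>Singles out a leading monomial among those of top total degree, with ties broken by the
  exponent of \<open>y\<close>. The total degree bounds that exponent, so a greatest one
  exists.\<close>

lemma total_degree_attained_top:
  assumes "h \<noteq> 0"
  obtains i j where "coeff (coeff h j) i \<noteq> 0" and "i + j = total_degree h"
    and "\<And>i' j'. coeff (coeff h j') i' \<noteq> 0 \<Longrightarrow> i' + j' = total_degree h \<Longrightarrow> j' \<le> j"
proof -
  let ?P = "\<lambda>j. \<exists>i. coeff (coeff h j) i \<noteq> 0 \<and> i + j = total_degree h"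
  obtain i0 j0 where "coeff (coeff h j0) i0 \<noteq> 0" "i0 + j0 = total_degree h"
    using total_degree_attained[OF assms] .
  then have ex: "?P j0"
    by blast
  have bound: "\<forall>j. ?P j \<longrightarrow> j \<le> total_degree h"
    by auto
  have "?P (GREATEST j. ?P j)"
    using GreatestI_nat[of ?P, OF ex] bound by blast
  moreover have "j' \<le> (GREATEST j. ?P j)" if "?P j'" for j'
    using Greatest_le_nat[of ?P, OF that] bound by blast
  ultimately show ?thesis
    using that by blast
qed

text \<open>The product of the two top coefficients, for the order by total degree and then by the
  exponent of \<open>y\<close>, is the only nonzero term of the corresponding coefficient of the product.\<close>

lemma total_degree_mult_ge:
  fixes f g :: "'a::idom poly poly"
  assumes "f \<noteq> 0" and "g \<noteq> 0"
  shows "total_degree f + total_degree g \<le> total_degree (f * g)"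
proof -
  obtain i j where f: "coeff (coeff f j) i \<noteq> 0" "i + j = total_degree f"
    and f_top: "\<And>i' j'. coeff (coeff f j') i' \<noteq> 0 \<Longrightarrow> i' + j' = total_degree f \<Longrightarrow> j' \<le> j"
    by (rule total_degree_attained_top[OF assms(1)]) blast
  obtain k l where g: "coeff (coeff g l) k \<noteq> 0" "k + l = total_degree g"
    and g_top: "\<And>k' l'. coeff (coeff g l') k' \<noteq> 0 \<Longrightarrow> k' + l' = total_degree g \<Longrightarrow> l' \<le> l"
    by (rule total_degree_attained_top[OF assms(2)]) blast
  let ?t = "\<lambda>(j', i'). coeff (coeff f j') i' * coeff (coeff g (j + l - j')) (i + k - i')"
  have top: "(j', i') = (j, i)"
    if "j' \<le> j + l" "i' \<le> i + k" and nz: "?t (j', i') \<noteq> 0" for i' j'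
  proof -
    have nzf: "coeff (coeff f j') i' \<noteq> 0"
      and nzg: "coeff (coeff g (j + l - j')) (i + k - i') \<noteq> 0"
      using nz by auto
    \<comment> \<open>The two degrees are at most \<open>total_degree f\<close> and
      \<open>total_degree g\<close> and add up to the sum of these, so both bounds are
      attained.\<close>
    have "i' + j' = total_degree f" "(i + k - i') + (j + l - j') = total_degree g"
      using le_total_degree[OF nzf] le_total_degree[OF nzg] f(2) g(2) that(1,2) by linarith+
    \<comment> \<open>Maximality of \<open>j\<close> gives \<open>j' \<le> j\<close>, and maximality
      of \<open>l\<close> gives the reverse inequality.\<close>
    then show ?thesis
      using f_top[OF nzf] g_top[OF nzg] f(2) that(1) by auto
  qed
  have "coeff (coeff (f * g) (j + l)) (i + k) = sum ?t ({..j + l} \<times> {..i + k})"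
    by (simp add: coeff_mult coeff_sum sum.cartesian_product)
  also have "\<dots> = sum ?t {(j, i)}"
    by (rule sum.mono_neutral_right) (use top in auto)
  also have "\<dots> \<noteq> 0"
    using f(1) g(1) by simp
  finally have "(i + k) + (j + l) \<le> total_degree (f * g)"
    by (rule le_total_degree)
  then show ?thesis
    using f(2) g(2) by simp
qed

lemma total_degree_eq_0_iff: "total_degree h = 0 \<longleftrightarrow> (\<exists>c. h = [:[:c:]:])"
proof
  assume td: "total_degree h = 0"
  have "coeff (coeff h j) i = 0" if "i + j > 0" for i j
    using le_total_degree[of h j i] td that by auto
  then have "h = [:[:coeff (coeff h 0) 0:]:]"
    by (auto simp: poly_eq_iff coeff_pCons split: nat.split)
  then show "\<exists>c. h = [:[:c:]:]" ..
next
  assume "\<exists>c. h = [:[:c:]:]"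
  then obtain c where h: "h = [:[:c:]:]" ..
  show "total_degree h = 0"
  proof (cases "h = 0")
    case True
    then show ?thesis
      by (simp add: total_degree_def)
  next
    case False
    then show ?thesis
      by (rule total_degree_attained) (auto simp: h coeff_pCons split: nat.splits)
  qed
qed

lemma is_unit_iff_total_degree:
  fixes h :: "'a::field poly poly"
  shows "is_unit h \<longleftrightarrow> h \<noteq> 0 \<and> total_degree h = 0"
  by (auto simp: total_degree_eq_0_iff is_unit_poly_iff is_unit_const_poly_iff dvd_field_iff)

text \<open>For \<open>d = a + b\<close>, twice the right side minus twice the left side is
  \<open>2 * (a - 1) * (b - 1)\<close>; the worst case is a linear factor.\<close>

lemma choose_two_factors:
  fixes a b d :: nat
  assumes "a \<ge> 1" and "b \<ge> 1" and "a + b \<le> d"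
  shows "((a + 2) choose 2) + ((b + 2) choose 2) \<le> ((d + 1) choose 2) + 3"
proof -
  have two: "2 * (Suc n choose 2) = Suc n * n" for n
    by (simp add: choose_two)
  obtain a' b' where ab: "a = Suc a'" "b = Suc b'"
    using assms(1,2) by (metis Suc_le_D One_nat_def)
  have "2 * ((a + 2) choose 2) + 2 * ((b + 2) choose 2) \<le> 2 * ((a + b + 1) choose 2) + 6"
    using two[of "a + 1"] two[of "b + 1"] two[of "a + b"] by (simp add: ab algebra_simps)
  moreover have "(a + b + 1) choose 2 \<le> (d + 1) choose 2"
    using assms(3) by (intro binomial_right_mono) simp
  ultimately show ?thesis
    by linarith
qed

lemma expansion_complexity_attained:
  fixes s :: "nat \<Rightarrow> 'a::{field,finite}"
  assumes "i < N" and "s i \<noteq> 0"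
  obtains h where "h \<noteq> 0" and "fps_X ^ N dvd subst_fps h (generating_function s)"
    and "total_degree h = expansion_complexity N s"
proof -
  let ?P = "\<lambda>d. \<exists>h. h \<noteq> 0 \<and> fps_X ^ N dvd subst_fps h (generating_function s)
    \<and> total_degree h = d"
  \<comment> \<open>The witness is \<open>x^N\<close>, free of \<open>y\<close>, which vanishes
    modulo \<open>x^N\<close> for every generating function.\<close>
  have "?P (total_degree [:monom (1::'a) N:])"
    by (intro exI[of _ "[:monom 1 N:]"]) (simp add: subst_fps_pCons fps_of_poly_monom)
  then have "?P (LEAST d. ?P d)"
    by (rule LeastI)
  moreover have "expansion_complexity N s = (LEAST d. ?P d)"
    using assms by (auto simp: expansion_complexity_def)
  ultimately show ?thesis
    using that by auto
qed

lemma expansion_complexity_le: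
  assumes "h \<noteq> 0" and "fps_X ^ N dvd subst_fps h (generating_function s)"
  shows "expansion_complexity N s \<le> total_degree h"
  unfolding expansion_complexity_def using assms by (auto intro!: Least_le)

text \<open>Irreducible candidates are in particular nonzero, so the i-expansion complexity is never
  the smaller one; an irreducible minimizer makes the two agree.\<close>

lemma i_expansion_complexity_eqI:
  assumes "i < N" and "s i \<noteq> 0" and "irreducible h"
    and "fps_X ^ N dvd subst_fps h (generating_function s)"
    and "total_degree h = expansion_complexity N s"
  shows "i_expansion_complexity N s = expansion_complexity N s"
proof -
  have "(LEAST d. \<exists>h. irreducible h \<and> fps_X ^ N dvd subst_fps h (generating_function s)
      \<and> total_degree h = d) = expansion_complexity N s"
    by (rule Least_equality) (use assms(3-5) in \<open>auto intro!: expansion_complexity_le\<close>)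
  then show ?thesis
    using assms(1,2) unfolding i_expansion_complexity_def by auto
qed

text \<open>A nonzero polynomial whose total degree lies below the complexity is not a candidate, so
  its value survives modulo that power of \<open>x\<close>. The strict bound saves 1 for each of two
  factors.\<close>

lemma subdegree_subst_fps_less:
  assumes maximal: "expansion_complexity ((total_degree f + 2) choose 2) s = total_degree f + 1"
    and "f \<noteq> 0"
  defines "F \<equiv> subst_fps f (generating_function s)"
  shows "F \<noteq> 0" and "subdegree F < (total_degree f + 2) choose 2"
proof -
  have not_dvd: "\<not> fps_X ^ ((total_degree f + 2) choose 2) dvd F"
    using expansion_complexity_le[OF assms(2)] maximal unfolding F_def by fastforce
  then show "F \<noteq> 0"
    by auto
  with not_dvd show "subdegree F < (total_degree f + 2) choose 2"
    by (simp add: fps_dvd_iff)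
qed

lemma i_expansion_complexity_of_maximal:
  fixes s :: "nat \<Rightarrow> 'a::{field,finite}"
  assumes maximal: "\<And>d N. d \<ge> 1 \<Longrightarrow> (d + 1) choose 2 \<le> N \<Longrightarrow> N < (d + 2) choose 2
                      \<Longrightarrow> expansion_complexity N s = d"
    and d: "d \<ge> 1" and N: "((d + 1) choose 2) + 2 \<le> N" "N < (d + 2) choose 2"
  shows "i_expansion_complexity N s = d"
proof -
  have EN: "expansion_complexity N s = d"
    using maximal d N by simp
  \<comment> \<open>A nonzero complexity at \<open>N = 1\<close> forces
    \<open>s 0 \<noteq> 0\<close>, which excludes the default value 0 for all positive
    \<open>N\<close>.\<close>
  have "expansion_complexity 1 s = 1"
    by (rule maximal) (simp_all add: choose_two)
  then have s0: "s 0 \<noteq> 0"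
    by (auto simp: expansion_complexity_def split: if_splits)
  have N0: "0 < N"
    using N(1) by simp
  obtain h where h: "h \<noteq> 0" "fps_X ^ N dvd subst_fps h (generating_function s)"
    "total_degree h = d"
    using expansion_complexity_attained[where s = s, OF N0 s0] EN by metis
  \<comment> \<open>\<open>(a + 2) choose 2\<close> is the left end of the range on which the
    complexity is \<open>a + 1\<close>.\<close>
  have next_complexity: "expansion_complexity ((a + 2) choose 2) s = a + 1" for a
    by (rule maximal) (simp_all add: choose_two)
  have "irreducible h"
  proof (rule irreducibleI)
    show "h \<noteq> 0"
      by (rule h)
    show "\<not> is_unit h"
      using h(3) d by (simp add: is_unit_iff_total_degree)
  next
    fix f g
    assume fg: "h = f * g"
    let ?F = "subst_fps f (generating_function s)" and ?G = "subst_fps g (generating_function s)"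
    have nz: "f \<noteq> 0" "g \<noteq> 0"
      using h(1) fg by auto
    have deg: "total_degree f + total_degree g \<le> d"
      using total_degree_mult_ge[OF nz] fg h(3) by simp
    note F = subdegree_subst_fps_less[OF next_complexity nz(1)]
    note G = subdegree_subst_fps_less[OF next_complexity nz(2)]
    have "N \<le> subdegree (?F * ?G)"
      using h(2) F(1) G(1) by (simp add: fg subst_fps_mult fps_dvd_iff)
    then have ord: "N \<le> subdegree ?F + subdegree ?G"
      using F(1) G(1) by simp
    have "total_degree f = 0 \<or> total_degree g = 0"
    proof (rule ccontr)
      assume "\<not> ?thesis"
      \<comment> \<open>The two strict bounds give
        \<open>N + 2 \<le> ((d + 1) choose 2) + 3\<close>, one short of the assumed lower bound on
        \<open>N\<close>.\<close>
      then show False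
        using choose_two_factors[OF _ _ deg] ord F(2) G(2) N(1) by simp
    qed
    then show "is_unit f \<or> is_unit g"
      using nz by (simp add: is_unit_iff_total_degree)
  qed
  then show ?thesis
    using i_expansion_complexity_eqI[where s = s, OF N0 s0 _ h(2)] h(3) EN by simp
qed

theorem theorem3:
  fixes s :: "nat \<Rightarrow> 'a::{field,finite}"
  assumes maximal: "\<And>d N :: nat. d \<ge> 1 \<Longrightarrow> (d + 1) choose 2 \<le> N \<Longrightarrow> N < (d + 2) choose 2
                      \<Longrightarrow> expansion_complexity N s = d"
  shows "\<forall>d' N :: nat. d' \<ge> 6 \<longrightarrow> ((d' + 1) choose 2) + 2 \<le> N \<longrightarrow> N < (d' + 2) choose 2
                      \<longrightarrow> i_expansion_complexity N s = d'"
  using i_expansion_complexity_of_maximal[OF maximal] by simp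

end
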